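(* Let $\Gamma$ be a graph arising as an oriented graph square. If $v \in V(\Gamma)$ is a cut vertex of $\Gamma$, then $v$ is a source or a sink in every oriented graph $\overrightarrow{G}$ such that $\Gamma = U(\overrightarrow{G}^2)$.
   Context: An oriented graph is obtained from a simple graph by orienting each edge as an arc. For an oriented graph $\overrightarrow{G}$, $\overrightarrow{G}^2$ is the mixed graph obtained from $\overrightarrow{G}$ by adding an undirected edge between every pair of vertices at directed distance two, and $U(\cdot)$ denotes the underlying simple graph. $\Gamma$ is an oriented graph square if $\Gamma = U(\overrightarrow{G}^2)$ for some oriented graph $\overrightarrow{G}$. A vertex $v$ is a source (resp. sink) of an oriented graph if all arcs incident with $v$ have their tail (resp. head) at $v$. *)

theory Defs
  imports "Graph_Theory.Graph_Theory"
begin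

text \<open>Digraphs without parallel arcs are the pair digraphs of the library. As there, an
  undirected simple graph is a symmetric loop-free digraph
  (\<^locale>\<open>pair_bidirected_digraph\<close>). Graphs are not required to be finite.\<close>

definition orientation_of :: "'a pair_pre_digraph \<Rightarrow> 'a pair_pre_digraph \<Rightarrow> bool" where
  "orientation_of G H \<longleftrightarrow>
     pverts G = pverts H \<and> parcs G \<subseteq> parcs H \<and>
     (\<forall>(u, v) \<in> parcs H. ((u, v) \<in> parcs G) \<noteq> ((v, u) \<in> parcs G))"

definition oriented_graph :: "'a pair_pre_digraph \<Rightarrow> bool" where
  "oriented_graph G \<longleftrightarrow> (\<exists>H. pair_bidirected_digraph H \<and> orientation_of G H)"

record 'a mixed_graph =
  mverts :: "'a set"
  marcs :: "'a rel"
  medges :: "'a set set"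

definition directed_distance :: "'a pair_pre_digraph \<Rightarrow> 'a \<Rightarrow> 'a \<Rightarrow> ereal" where
  "directed_distance G u v = wf_digraph.\<mu> (with_proj G) (\<lambda>_. 1) u v"

definition oriented_square :: "'a pair_pre_digraph \<Rightarrow> 'a mixed_graph" where
  "oriented_square G =
     \<lparr> mverts = pverts G,
       marcs = parcs G,
       medges = {{u, w} | u w. u \<in> pverts G \<and> w \<in> pverts G \<and> directed_distance G u w = 2} \<rparr>"

definition underlying_graph :: "'a mixed_graph \<Rightarrow> 'a pair_pre_digraph" where
  "underlying_graph M =
     \<lparr> pverts = mverts M,
       parcs = (marcs M)\<^sup>s \<union> {(u, w). {u, w} \<in> medges M} \<rparr>"

definition is_oriented_graph_square :: "'a pair_pre_digraph \<Rightarrow> bool" where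
  "is_oriented_graph_square \<Gamma> \<longleftrightarrow>
     (\<exists>G. oriented_graph G \<and> \<Gamma> = underlying_graph (oriented_square G))"

definition source :: "'a pair_pre_digraph \<Rightarrow> 'a \<Rightarrow> bool" where
  "source G v \<longleftrightarrow> v \<in> pverts G \<and> (\<forall>a \<in> parcs G. fst a = v \<or> snd a = v \<longrightarrow> fst a = v)"

definition sink :: "'a pair_pre_digraph \<Rightarrow> 'a \<Rightarrow> bool" where
  "sink G v \<longleftrightarrow> v \<in> pverts G \<and> (\<forall>a \<in> parcs G. fst a = v \<or> snd a = v \<longrightarrow> snd a = v)"

text \<open>A cut vertex separates two other vertices of the same component. This makes sense for
  infinite graphs; for finite ones it says that deleting the vertex increases the number of
  components (\<open>cut_vertex_iff_card_components\<close> below).\<close>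

definition cut_vertex :: "'a pair_pre_digraph \<Rightarrow> 'a \<Rightarrow> bool" where
  "cut_vertex \<Gamma> v \<longleftrightarrow> v \<in> pverts \<Gamma> \<and>
     (\<exists>x \<in> pverts \<Gamma> - {v}. \<exists>y \<in> pverts \<Gamma> - {v}.
        x \<rightarrow>\<^sup>*\<^bsub>with_proj \<Gamma>\<^esub> y \<and>
        \<not> x \<rightarrow>\<^sup>*\<^bsub>pre_digraph.del_vert (with_proj \<Gamma>) v\<^esub> y)"

lemma oriented_graph_iff:
  "oriented_graph G \<longleftrightarrow>
     pair_wf_digraph G \<and> (\<forall>u v. (u, v) \<in> parcs G \<longrightarrow> (v, u) \<notin> parcs G)"
proof
  assume "oriented_graph G"
  then obtain H where H: "pair_bidirected_digraph H" and o: "orientation_of G H"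
    by (auto simp: oriented_graph_def)
  interpret pair_bidirected_digraph H by (rule H)
  show "pair_wf_digraph G \<and> (\<forall>u v. (u, v) \<in> parcs G \<longrightarrow> (v, u) \<notin> parcs G)"
    using o arc_fst_in_verts arc_snd_in_verts
    unfolding orientation_of_def pair_wf_digraph_def by fastforce
next
  assume r: "pair_wf_digraph G \<and> (\<forall>u v. (u, v) \<in> parcs G \<longrightarrow> (v, u) \<notin> parcs G)"
  let ?H = "\<lparr> pverts = pverts G, parcs = (parcs G)\<^sup>s \<rparr>"
  have "pair_bidirected_digraph ?H"
    using r by unfold_locales
      (fastforce simp: pair_wf_digraph_def symcl_def symmetric_def sym_def)+
  moreover have "orientation_of G ?H"
    using r by (auto simp: orientation_of_def symcl_def)
  ultimately show "oriented_graph G" unfolding oriented_graph_def by blast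
qed

lemma directed_distance_eq_2_iff:
  assumes "pair_wf_digraph G"
  shows "directed_distance G u w = 2 \<longleftrightarrow>
    u \<noteq> w \<and> (u, w) \<notin> parcs G \<and> (\<exists>v. (u, v) \<in> parcs G \<and> (v, w) \<in> parcs G)"
    (is "?L \<longleftrightarrow> ?R")
proof -
  interpret pair_wf_digraph G by (rule assms)
  have cost: "awalk_cost (\<lambda>_. 1) p = real (length p)" for p :: "('a \<times> 'a) list"
    by (induct p) auto
  have dd: "directed_distance G u w = (INF p\<in>{p. awalk u p w}. ereal (real (length p)))"
    unfolding directed_distance_def \<mu>_def cost ..
  show ?thesis
  proof
    assume L: ?L
    have ge: "length p \<ge> 2" if "awalk u p w" for p
    proof -
      have "directed_distance G u w \<le> ereal (real (length p))"
        unfolding dd using that by (intro INF_lower) auto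
      then show ?thesis using L by simp
    qed
    have "\<exists>p. awalk u p w \<and> length p < 3"
    proof (rule ccontr)
      assume "\<not> ?thesis"
      then have "ereal 3 \<le> directed_distance G u w"
        unfolding dd by (intro INF_greatest) (auto simp: not_less)
      then show False using L by simp
    qed
    then obtain p where p: "awalk u p w" "length p < 3" by blast
    then have "length p = 2" using ge[of p] by simp
    then obtain a b where "p = [a, b]" by (auto simp: numeral_2_eq_2 length_Suc_conv)
    with p have "\<exists>v. (u, v) \<in> parcs G \<and> (v, w) \<in> parcs G"
      by (cases a; cases b) (auto simp: awalk_Cons_iff awalk_Nil_iff)
    moreover have "u \<noteq> w"
    proof
      assume "u = w"
      then have "awalk u [] w" using p(1) by (auto simp: awalk_Nil_iff)
      from ge[OF this] show False by simp
    qed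
    moreover have "(u, w) \<notin> parcs G"
    proof
      assume "(u, w) \<in> parcs G"
      then have "awalk u [(u, w)] w" by (auto simp: awalk_Cons_iff awalk_Nil_iff dest: wellformed')
      from ge[OF this] show False by simp
    qed
    ultimately show ?R by blast
  next
    assume R: ?R
    then obtain v where v: "(u, v) \<in> parcs G" "(v, w) \<in> parcs G" by blast
    then have "awalk u [(u, v), (v, w)] w"
      by (auto simp: awalk_Cons_iff awalk_Nil_iff dest: wellformed')
    then have "directed_distance G u w \<le> ereal (real (length [(u, v), (v, w)]))"
      unfolding dd by (intro INF_lower) auto
    moreover have "ereal 2 \<le> directed_distance G u w"
      unfolding dd
    proof (intro INF_greatest)
      fix p assume "p \<in> {p. awalk u p w}"
      then have p: "awalk u p w" by simp
      have "p \<noteq> []" using p R by (auto simp: awalk_Nil_iff)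
      moreover have "p \<noteq> [a]" for a using p R
        by (cases a) (auto simp: awalk_Cons_iff awalk_Nil_iff)
      ultimately have "length p \<ge> 2"
        by (cases p; cases "tl p") auto
      then show "ereal 2 \<le> ereal (real (length p))" by simp
    qed
    ultimately show ?L by (simp add: antisym)
  qed
qed

lemma underlying_oriented_square_simple:
  assumes "oriented_graph G"
  shows "pair_bidirected_digraph (underlying_graph (oriented_square G))"
proof -
  have wf: "pair_wf_digraph G" and asym: "\<And>u v. (u, v) \<in> parcs G \<Longrightarrow> (v, u) \<notin> parcs G"
    using assms by (auto simp: oriented_graph_iff)
  interpret pair_wf_digraph G by (rule wf)
  let ?U = "underlying_graph (oriented_square G)"
  have U: "pverts ?U = pverts G"
    "(u, w) \<in> parcs ?U \<longleftrightarrow> u \<noteq> w \<and>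
      ((u, w) \<in> parcs G \<or> (w, u) \<in> parcs G \<or>
       (\<exists>v. (u, v) \<in> parcs G \<and> (v, w) \<in> parcs G) \<or>
       (\<exists>v. (w, v) \<in> parcs G \<and> (v, u) \<in> parcs G))" for u w
  proof -
    have "{u, w} \<in> medges (oriented_square G) \<longleftrightarrow>
        u \<in> pverts G \<and> w \<in> pverts G \<and> (directed_distance G u w = 2 \<or> directed_distance G w u = 2)"
      unfolding oriented_square_def by (auto simp: doubleton_eq_iff)
    then have "(u, w) \<in> parcs ?U \<longleftrightarrow> (u, w) \<in> parcs G \<or> (w, u) \<in> parcs G \<or>
        u \<in> pverts G \<and> w \<in> pverts G \<and> (directed_distance G u w = 2 \<or> directed_distance G w u = 2)"
      unfolding underlying_graph_def by (auto simp: oriented_square_def symcl_def)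
    then show "(u, w) \<in> parcs ?U \<longleftrightarrow> u \<noteq> w \<and>
      ((u, w) \<in> parcs G \<or> (w, u) \<in> parcs G \<or>
       (\<exists>v. (u, v) \<in> parcs G \<and> (v, w) \<in> parcs G) \<or>
       (\<exists>v. (w, v) \<in> parcs G \<and> (v, u) \<in> parcs G))"
      unfolding directed_distance_eq_2_iff[OF wf] using asym wellformed' by blast
  qed (simp add: underlying_graph_def oriented_square_def)
  show ?thesis
    by unfold_locales (auto simp: U symmetric_def sym_def dest: wellformed')
qed

lemma cut_vertex_iff_card_components:
  assumes "pair_bidirected_digraph \<Gamma>" "finite (pverts \<Gamma>)" "v \<in> pverts \<Gamma>"
  shows "cut_vertex \<Gamma> v \<longleftrightarrow>
    card (pre_digraph.sccs (pre_digraph.del_vert (with_proj \<Gamma>) v)) >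
      card (pre_digraph.sccs (with_proj \<Gamma>))"
proof -
  interpret G: pair_bidirected_digraph \<Gamma> by (rule assms)
  let ?H = "pre_digraph.del_vert (with_proj \<Gamma>) v"
  interpret H: wf_digraph ?H by (rule G.wf_digraph_del_vert)
  have "symmetric ?H"
    using G.pair_sym_arcs
    by (auto simp: symmetric_def sym_def arcs_ends_conv pre_digraph.del_vert_simps) 
  then interpret H: sym_digraph ?H by unfold_locales
  let ?V = "pverts \<Gamma> - {v}"
  have vH: "verts ?H = ?V" by (simp add: pre_digraph.del_vert_simps)
  have mono: "x \<rightarrow>\<^sup>*\<^bsub>with_proj \<Gamma>\<^esub> y" if "x \<rightarrow>\<^sup>*\<^bsub>?H\<^esub> y" for x y
    using that unfolding reachable_def
    by (rule rtrancl_on_mono[rotated 2]) (auto simp: pre_digraph.del_vert_simps arcs_ends_conv)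
  define \<phi> where "\<phi> T = {y. \<exists>x\<in>T. x \<rightarrow>\<^sup>*\<^bsub>with_proj \<Gamma>\<^esub> y}" for T
  have symG: "x \<rightarrow>\<^sup>*\<^bsub>with_proj \<Gamma>\<^esub> y \<longleftrightarrow> y \<rightarrow>\<^sup>*\<^bsub>with_proj \<Gamma>\<^esub> x" for x y
    using symmetric_reachable[OF G.pair_sym_arcs] by blast
  have symH: "x \<rightarrow>\<^sup>*\<^bsub>?H\<^esub> y \<longleftrightarrow> y \<rightarrow>\<^sup>*\<^bsub>?H\<^esub> x" for x y
    using symmetric_reachable[OF H.sym_arcs] by blast
  have sG: "G.scc_of x = {y. x \<rightarrow>\<^sup>*\<^bsub>with_proj \<Gamma>\<^esub> y}" for x
    unfolding G.scc_of_def using symG by blast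
  have sH: "H.scc_of x = {y. x \<rightarrow>\<^sup>*\<^bsub>?H\<^esub> y}" for x
    unfolding H.scc_of_def using symH by blast
  have eqG: "G.scc_of x = G.scc_of y \<longleftrightarrow> x \<rightarrow>\<^sup>*\<^bsub>with_proj \<Gamma>\<^esub> y" if "x \<in> ?V" "y \<in> pverts \<Gamma>" for x y
    unfolding sG using that symG G.reachable_trans G.reachable_refl by blast
  have eqH: "H.scc_of x = H.scc_of y \<longleftrightarrow> x \<rightarrow>\<^sup>*\<^bsub>?H\<^esub> y" if "x \<in> ?V" "y \<in> ?V" for x y
    unfolding sH using that symH H.reachable_trans H.reachable_refl[unfolded vH] by blast
  have phi: "\<phi> (H.scc_of x) = G.scc_of x" if "x \<in> ?V" for x
    unfolding \<phi>_def sG sH using that mono G.reachable_trans H.reachable_refl[unfolded vH] by blast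
  let ?A = "H.scc_of ` ?V" and ?B = "G.scc_of ` pverts \<Gamma>"
  have cards: "card H.sccs = card ?A" "card G.sccs = card ?B"
    using H.card_sccs_verts G.card_sccs_verts H.sccs_verts_conv_scc_of G.sccs_verts_conv_scc_of
    by (simp_all add: vH)
  have finA: "finite ?A" and finB: "finite ?B" using assms(2) by auto
  have im: "\<phi> ` ?A = G.scc_of ` ?V" using phi by (simp add: image_image)
  have "cut_vertex \<Gamma> v \<longleftrightarrow> card ?A > card ?B"
  proof
    assume "cut_vertex \<Gamma> v"
    then obtain x y where xy: "x \<in> ?V" "y \<in> ?V" "x \<rightarrow>\<^sup>*\<^bsub>with_proj \<Gamma>\<^esub> y" "\<not> x \<rightarrow>\<^sup>*\<^bsub>?H\<^esub> y"
      unfolding cut_vertex_def by blast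
    have "\<not> inj_on \<phi> ?A"
    proof
      assume "inj_on \<phi> ?A"
      then have "H.scc_of x = H.scc_of y"
        by (rule inj_onD) (use phi eqG xy in auto)
      then show False using eqH xy by blast
    qed
    then have lt: "card (\<phi> ` ?A) < card ?A"
      using finA card_image_le eq_card_imp_inj_on le_neq_implies_less by metis
    show "card ?A > card ?B"
    proof (cases "G.scc_of v \<in> G.scc_of ` ?V")
      case True
      then have "?B = G.scc_of ` ?V" using assms(3) by auto
      then show ?thesis using lt im by simp
    next
      case False
      then have nv: "\<not> z \<rightarrow>\<^sup>*\<^bsub>with_proj \<Gamma>\<^esub> v" if "z \<in> ?V" for z
        using eqG[OF that assms(3)] that by (metis image_eqI)
      from xy(3) have "x \<rightarrow>\<^sup>*\<^bsub>?H\<^esub> y"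
      proof (induct rule: G.reachable_induct)
        case base
        show ?case using xy(1) vH by auto
      next
        case (step a b)
        have "x \<rightarrow>\<^sup>*\<^bsub>with_proj \<Gamma>\<^esub> b" using step(1,2) by (rule G.reachable_adj_trans)
        then have "a \<noteq> v" "b \<noteq> v" using nv[OF xy(1)] step(1) by auto
        then have "a \<rightarrow>\<^bsub>?H\<^esub> b"
          using step(2) by (auto simp: arcs_ends_conv pre_digraph.del_vert_simps image_iff)
        with step(3) show ?case by (rule H.reachable_adj_trans)
      qed
      then show ?thesis using xy(4) by blast
    qed
  next
    assume gt: "card ?A > card ?B"
    show "cut_vertex \<Gamma> v"
    proof (rule ccontr)
      assume nc: "\<not> cut_vertex \<Gamma> v"
      have "inj_on \<phi> ?A"
      proof (rule inj_onI)
        fix S T assume "S \<in> ?A" "T \<in> ?A" and e: "\<phi> S = \<phi> T"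
        then obtain x y where xy: "x \<in> ?V" "y \<in> ?V" "S = H.scc_of x" "T = H.scc_of y" by blast
        then have "x \<rightarrow>\<^sup>*\<^bsub>with_proj \<Gamma>\<^esub> y" using e phi eqG by auto
        then have "x \<rightarrow>\<^sup>*\<^bsub>?H\<^esub> y" using nc xy assms(3) unfolding cut_vertex_def by blast
        then show "S = T" using eqH xy by blast
      qed
      then have "card ?A = card (G.scc_of ` ?V)" using im card_image by metis
      also have "\<dots> \<le> card ?B" using finB by (intro card_mono) auto
      finally show False using gt by simp
    qed
  qed
  then show ?thesis using cards by simp
qed

end

theory Submission
  imports Defs
begin

text \<open>If \<open>v\<close> has both an in-neighbour and an out-neighbour in \<open>G\<close>, then in the square every
  in-neighbour is adjacent to every out-neighbour, while a vertex joined to \<open>v\<close> by a directed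
  path of length two is adjacent to the midpoint of that path. So all neighbours of \<open>v\<close> in the
  square lie in one component after deleting \<open>v\<close>, and every walk through \<open>v\<close> can be rerouted.\<close>

text \<open>Distances disappear here: a directed two-path whose ends also carry an arc falls short
  of distance two, but that arc already makes the ends adjacent. Asymmetry excludes loops, so arcs
  join distinct vertices.\<close>

lemma parcs_underlying_oriented_square:
  assumes "oriented_graph G"
  shows "(u, w) \<in> parcs (underlying_graph (oriented_square G)) \<longleftrightarrow> u \<noteq> w \<and>
      ((u, w) \<in> parcs G \<or> (w, u) \<in> parcs G \<or>
       (\<exists>v. (u, v) \<in> parcs G \<and> (v, w) \<in> parcs G) \<or>
       (\<exists>v. (w, v) \<in> parcs G \<and> (v, u) \<in> parcs G))"
proof -
  have wf: "pair_wf_digraph G" and asym: "\<And>u v. (u, v) \<in> parcs G \<Longrightarrow> (v, u) \<notin> parcs G"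
    using assms by (auto simp: oriented_graph_iff)
  interpret pair_wf_digraph G by (rule wf)
  have "{u, w} \<in> medges (oriented_square G) \<longleftrightarrow>
      u \<in> pverts G \<and> w \<in> pverts G \<and> (directed_distance G u w = 2 \<or> directed_distance G w u = 2)"
    unfolding oriented_square_def by (auto simp: doubleton_eq_iff)
  then have "(u, w) \<in> parcs (underlying_graph (oriented_square G)) \<longleftrightarrow>
      (u, w) \<in> parcs G \<or> (w, u) \<in> parcs G \<or>
      u \<in> pverts G \<and> w \<in> pverts G \<and> (directed_distance G u w = 2 \<or> directed_distance G w u = 2)"
    unfolding underlying_graph_def by (auto simp: oriented_square_def symcl_def)
  then show ?thesis
    unfolding directed_distance_eq_2_iff[OF wf] using asym wellformed' by blast
qed

lemma symmetric_del_vert: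
  assumes "pair_bidirected_digraph \<Gamma>"
  shows "symmetric (pre_digraph.del_vert (with_proj \<Gamma>) v)"
proof -
  interpret pair_bidirected_digraph \<Gamma> by (rule assms)
  show ?thesis
    using pair_sym_arcs
    by (auto simp: symmetric_def sym_def arcs_ends_conv pre_digraph.del_vert_simps)
qed

lemma dominates_del_vert_iff:
  "a \<rightarrow>\<^bsub>pre_digraph.del_vert (with_proj \<Gamma>) v\<^esub> b \<longleftrightarrow> (a, b) \<in> parcs \<Gamma> \<and> a \<noteq> v \<and> b \<noteq> v"
  by (auto simp: arcs_ends_conv pre_digraph.del_vert_simps image_iff)

text \<open>The vertex \<open>w\<close> acts as a hub: a walk enters and leaves \<open>v\<close>
  through neighbours of \<open>v\<close>, and both reach \<open>w\<close> without using
  \<open>v\<close>.\<close>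

lemma not_cut_vertex_if_neighbours_connected:
  assumes "pair_bidirected_digraph \<Gamma>"
    and conn: "\<And>a. (a, v) \<in> parcs \<Gamma> \<Longrightarrow> a \<rightarrow>\<^sup>*\<^bsub>pre_digraph.del_vert (with_proj \<Gamma>) v\<^esub> w"
  shows "\<not> cut_vertex \<Gamma> v"
proof
  assume "cut_vertex \<Gamma> v"
  interpret G: pair_bidirected_digraph \<Gamma> by (rule assms)
  let ?H = "pre_digraph.del_vert (with_proj \<Gamma>) v"
  interpret H: wf_digraph ?H by (rule G.wf_digraph_del_vert)
  obtain x y where x: "x \<in> pverts \<Gamma> - {v}" and y: "y \<in> pverts \<Gamma> - {v}"
    and xy: "x \<rightarrow>\<^sup>*\<^bsub>with_proj \<Gamma>\<^esub> y" and nxy: "\<not> x \<rightarrow>\<^sup>*\<^bsub>?H\<^esub> y"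
    using \<open>cut_vertex \<Gamma> v\<close> unfolding cut_vertex_def by blast
  \<comment> \<open>Prefixes of the walk may end at \<open>v\<close>, which is absent from
    \<open>?H\<close>, so the induction lets \<open>w\<close> stand in for \<open>v\<close>. At the
    end \<open>y\<close> differs from \<open>v\<close>, and the conditional vanishes.\<close>
  from xy have "x \<rightarrow>\<^sup>*\<^bsub>?H\<^esub> (if y = v then w else y)"
  proof (induct rule: G.reachable_induct)
    case base
    show ?case using x by (auto simp: pre_digraph.del_vert_simps)
  next
    case (step a b)
    have ab: "(a, b) \<in> parcs \<Gamma>" using step(2) by auto
    then have ba: "(b, a) \<in> parcs \<Gamma>" by (rule G.arcs_symmetric)
    have "a \<noteq> b" using ab by (rule G.no_loops')
    then consider "a = v" "b \<noteq> v" | "a \<noteq> v" "b = v" | "a \<noteq> v" "b \<noteq> v" by blast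
    then show ?case
    proof cases
      \<comment> \<open>The walk leaves \<open>v\<close> for \<open>b\<close>: the detour from the
        hub to \<open>b\<close> is \<open>conn\<close> reversed by symmetry.\<close>
      case 1
      have "b \<rightarrow>\<^sup>*\<^bsub>?H\<^esub> w" using ba unfolding 1(1) by (rule conn)
      then have "w \<rightarrow>\<^sup>*\<^bsub>?H\<^esub> b"
        by (rule symmetric_reachable[OF symmetric_del_vert[OF assms(1)]])
      moreover have "x \<rightarrow>\<^sup>*\<^bsub>?H\<^esub> w" using step(3) 1 by simp
      ultimately have "x \<rightarrow>\<^sup>*\<^bsub>?H\<^esub> b" by (metis H.reachable_trans)
      then show ?thesis using 1 by simp
    next
      case 2
      have "a \<rightarrow>\<^sup>*\<^bsub>?H\<^esub> w" using ab unfolding 2(2) by (rule conn)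
      moreover have "x \<rightarrow>\<^sup>*\<^bsub>?H\<^esub> a" using step(3) 2 by simp
      ultimately have "x \<rightarrow>\<^sup>*\<^bsub>?H\<^esub> w" by (metis H.reachable_trans)
      then show ?thesis using 2 by simp
    next
      case 3
      then have "a \<rightarrow>\<^bsub>?H\<^esub> b" using ab unfolding dominates_del_vert_iff by blast
      moreover have "x \<rightarrow>\<^sup>*\<^bsub>?H\<^esub> a" using step(3) 3 by simp
      ultimately have "x \<rightarrow>\<^sup>*\<^bsub>?H\<^esub> b" by (metis H.reachable_adj_trans)
      then show ?thesis using 3 by simp
    qed
  qed
  then show False using y nxy by simp
qed

lemma not_cut_vertex_oriented_square:
  assumes G: "oriented_graph G" and in_arc: "(u, v) \<in> parcs G" and out_arc: "(v, w) \<in> parcs G"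
  shows "\<not> cut_vertex (underlying_graph (oriented_square G)) v"
proof -
  let ?U = "underlying_graph (oriented_square G)"
  let ?H = "pre_digraph.del_vert (with_proj ?U) v"
  have U: "pair_bidirected_digraph ?U" by (rule underlying_oriented_square_simple[OF G])
  interpret U: pair_bidirected_digraph ?U by (rule U)
  interpret H: wf_digraph ?H by (rule U.wf_digraph_del_vert)
  have asym: "\<And>a b. (a, b) \<in> parcs G \<Longrightarrow> (b, a) \<notin> parcs G"
    using G by (auto simp: oriented_graph_iff)
  note arcs = parcs_underlying_oriented_square[OF G]
  have adj: "a \<rightarrow>\<^bsub>?H\<^esub> b \<longleftrightarrow> (a, b) \<in> parcs ?U \<and> a \<noteq> v \<and> b \<noteq> v" for a b
    by (rule dominates_del_vert_iff)
  \<comment> \<open>The two-path from \<open>a\<close> through \<open>v\<close> to \<open>b\<close>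
    makes \<open>a\<close> and \<open>b\<close> adjacent in the square; asymmetry gives that
    \<open>a\<close>, \<open>b\<close> and \<open>v\<close> are distinct.\<close>
  have in_out: "a \<rightarrow>\<^bsub>?H\<^esub> b" "b \<rightarrow>\<^bsub>?H\<^esub> a" if "(a, v) \<in> parcs G" "(v, b) \<in> parcs G" for a b
    unfolding adj arcs using that asym by blast+
  have in_w: "a \<rightarrow>\<^sup>*\<^bsub>?H\<^esub> w" if "(a, v) \<in> parcs G" for a
    using in_out(1)[OF that out_arc] by (rule H.reachable_adjI)
  \<comment> \<open>Two out-neighbours of \<open>v\<close> need not be adjacent, so the connection
    passes through the in-neighbour \<open>u\<close>.\<close>
  have out_w: "b \<rightarrow>\<^sup>*\<^bsub>?H\<^esub> w" if "(v, b) \<in> parcs G" for b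
    using in_out(2)[OF in_arc that] in_w[OF in_arc] by (rule H.adj_reachable_trans)
  have "a \<rightarrow>\<^sup>*\<^bsub>?H\<^esub> w" if a: "(a, v) \<in> parcs ?U" for a
  proof -
    consider "(a, v) \<in> parcs G" | "(v, a) \<in> parcs G"
      | z where "(a, z) \<in> parcs G" "(z, v) \<in> parcs G"
      | z where "(v, z) \<in> parcs G" "(z, a) \<in> parcs G"
      using a unfolding arcs by blast
    then show ?thesis
    proof cases
      \<comment> \<open>The midpoint \<open>z\<close> is an in-neighbour of \<open>v\<close>, and
        asymmetry keeps \<open>a\<close> and \<open>z\<close> distinct from \<open>v\<close>. The
        next case is the mirror image.\<close>
      case 3
      then have "a \<rightarrow>\<^bsub>?H\<^esub> z" unfolding adj arcs using asym by blast
      then show ?thesis using in_w[OF 3(2)] by (rule H.adj_reachable_trans)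
    next
      case 4
      then have "a \<rightarrow>\<^bsub>?H\<^esub> z" unfolding adj arcs using asym by blast
      then show ?thesis using out_w[OF 4(1)] by (rule H.adj_reachable_trans)
    qed (fact in_w out_w)+
  qed
  then show ?thesis by (rule not_cut_vertex_if_neighbours_connected[OF U])
qed

theorem theorem2p5:
  fixes \<Gamma> :: "'a pair_pre_digraph" and v :: 'a
  assumes "is_oriented_graph_square \<Gamma>"
    and "v \<in> pverts \<Gamma>"
    and "cut_vertex \<Gamma> v"
  shows "\<forall>G. oriented_graph G \<and> \<Gamma> = underlying_graph (oriented_square G) \<longrightarrow>
           source G v \<or> sink G v"
proof (intro allI impI, elim conjE)
  fix G assume G: "oriented_graph G" and \<Gamma>: "\<Gamma> = underlying_graph (oriented_square G)"
  have "v \<in> pverts G"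
    using assms(2) by (simp add: \<Gamma> underlying_graph_def oriented_square_def)
  \<comment> \<open>If \<open>v\<close> is not a source, some arc enters it; if it is not a sink,
    some arc leaves it. Both cannot occur at a cut vertex.\<close>
  moreover have "(u, v) \<notin> parcs G \<or> (v, w) \<notin> parcs G" for u w
    using not_cut_vertex_oriented_square[OF G, of u v w] assms(3) \<Gamma> by auto
  ultimately show "source G v \<or> sink G v"
    unfolding source_def sink_def by fastforce
qed

end
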